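(* Let $U$ be an open subset of some $\mathbf R^n$ and let $\phi:U\times\mathbf R\to\mathbf R$ be a test plot, i.e. smooth and locally (on $U$) of uniformly bounded support. Then the function $\Phi:U\times\mathbf R_{\ge 0}\to\mathbf R$ defined by $\Phi(u,t):=\langle K(t),\phi(u,-)\rangle$ is smooth, where $K$ is the heat kernel.
   Context: A map $\phi:U\times\mathbf R\to\mathbf R$ is locally of uniformly bounded support if $U$ can be covered by open subsets $U_i$ such that for each $i$ there is $b$ with $\phi(u,x)=0$ for all $u\in U_i$ and all $x$ with $|x|>b$. The heat kernel is the family of distributions $K(t)$, $t\ge0$, on $\mathbf R$ given for a smooth function $\psi$ of compact support by $\langle K(t),\psi\rangle=\int_{-\infty}^{\infty}\frac{e^{-s^2/4t}}{\sqrt{4\pi t}}\,\psi(s)\,ds$ if $t>0$, and $\langle K(0),\psi\rangle=\psi(0)$. Smoothness of a function on $U\times\mathbf R_{\ge 0}$ is in the diffeological sense: $\Phi\circ p$ is smooth for every open subset $V$ of some $\mathbf R^m$ and every map $p:V\to U\times\mathbf R_{\ge 0}$ which is smooth as a map into $U\times\mathbf R$. *)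

theory Defs
  imports "HOL-Analysis.Analysis"
begin

text \<open>
  The spaces \<open>\<real>\<^sup>n\<close> for all \<open>n \<ge> 0\<close>: real inner product spaces with a finite orthonormal basis.
  The class \<^class>\<open>euclidean_space\<close> is the same thing restricted to \<open>n \<ge> 1\<close>, since it
  requires a nonempty basis; \<open>\<real>\<^sup>0\<close> is admitted here because it is a legitimate parameter space
  for plots.
\<close>

class cartesian_space = real_inner +
  assumes ex_orthonormal_basis:
    "\<exists>B. finite B \<and> (\<forall>b\<in>B. \<forall>c\<in>B. inner b c = (if b = c then 1 else 0)) \<and>
         (\<forall>x. (\<forall>b\<in>B. inner x b = 0) \<longrightarrow> x = 0)"

instance euclidean_space \<subseteq> cartesian_space
  by standard
     (rule exI[of _ Basis], auto simp: inner_Basis euclidean_all_zero_iff)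

datatype real_0 = Origin

lemma real_0_eq: "x = y" for x y :: real_0
  by (cases x, cases y) simp

instantiation real_0 :: real_inner
begin

definition "(0 :: real_0) = Origin"
definition "(x :: real_0) + y = Origin"
definition "(x :: real_0) - y = Origin"
definition "- (x :: real_0) = Origin"
definition "(r :: real) *\<^sub>R (x :: real_0) = Origin"
definition "inner (x :: real_0) (y :: real_0) = (0 :: real)"
definition "norm (x :: real_0) = (0 :: real)"
definition "sgn (x :: real_0) = Origin"
definition "dist (x :: real_0) (y :: real_0) = (0 :: real)"
definition "(uniformity :: (real_0 \<times> real_0) filter) =
  (INF e\<in>{0<..}. principal {(x, y). dist x y < e})"
definition "open (S :: real_0 set) \<longleftrightarrow>
  (\<forall>x\<in>S. eventually (\<lambda>(x', y). x' = x \<longrightarrow> y \<in> S) uniformity)"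

instance
proof
  show "uniformity = (INF e\<in>{0<..}. principal {(x :: real_0, y). dist x y < e})"
    by (rule uniformity_real_0_def)
  show "open S \<longleftrightarrow> (\<forall>x\<in>S. eventually (\<lambda>(x', y). x' = x \<longrightarrow> y \<in> S) uniformity)"
    for S :: "real_0 set"
    by (rule open_real_0_def)
qed (auto simp: zero_real_0_def plus_real_0_def minus_real_0_def uminus_real_0_def
      scaleR_real_0_def inner_real_0_def norm_real_0_def sgn_real_0_def dist_real_0_def
      intro: real_0_eq)

end

instance real_0 :: cartesian_space
proof
  show "\<exists>B :: real_0 set. finite B \<and>
      (\<forall>b\<in>B. \<forall>c\<in>B. inner b c = (if b = c then 1 else 0)) \<and>
      (\<forall>x. (\<forall>b\<in>B. inner x b = 0) \<longrightarrow> x = 0)"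
    by (intro exI[of _ "{}"]) (simp add: real_0_eq)
qed

text \<open>
  \<open>C\<^sup>k\<close> on an open subset of a finite-dimensional space, by recursion over the directional
  derivatives. The derivative is taken at \<open>x\<close> in the ambient space, so these two notions are
  meant for open sets only.
\<close>

primrec C_on :: "nat \<Rightarrow> 'a::real_normed_vector set \<Rightarrow> ('a \<Rightarrow> 'b::real_normed_vector) \<Rightarrow> bool"
  where
    "C_on 0 S f \<longleftrightarrow> continuous_on S f"
  | "C_on (Suc k) S f \<longleftrightarrow>
       (\<forall>x\<in>S. f differentiable (at x)) \<and>
       (\<forall>v. C_on k S (\<lambda>x. frechet_derivative f (at x) v))"

definition smooth_on :: "'a::real_normed_vector set \<Rightarrow> ('a \<Rightarrow> 'b::real_normed_vector) \<Rightarrow> bool"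
  where "smooth_on S f \<longleftrightarrow> (\<forall>k. C_on k S f)"

definition locally_unif_bounded_support ::
    "'a::topological_space set \<Rightarrow> ('a \<times> real \<Rightarrow> real) \<Rightarrow> bool"
  where "locally_unif_bounded_support U \<phi> \<longleftrightarrow>
    (\<exists>\<C>. (\<forall>W\<in>\<C>. open W \<and> W \<subseteq> U) \<and> U \<subseteq> \<Union>\<C> \<and>
         (\<forall>W\<in>\<C>. \<exists>b::real. \<forall>u\<in>W. \<forall>x. \<bar>x\<bar> > b \<longrightarrow> \<phi> (u, x) = 0))"

definition test_plot :: "'a::real_normed_vector set \<Rightarrow> ('a \<times> real \<Rightarrow> real) \<Rightarrow> bool"
  where "test_plot U \<phi> \<longleftrightarrow>
    smooth_on (U \<times> UNIV) \<phi> \<and> locally_unif_bounded_support U \<phi>"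

text \<open>The pairing \<open>\<langle>K(t), \<psi>\<rangle>\<close>; only \<open>t \<ge> 0\<close> and test functions \<open>\<psi>\<close> are meaningful.\<close>

definition heat_kernel :: "real \<Rightarrow> (real \<Rightarrow> real) \<Rightarrow> real"
  where "heat_kernel t \<psi> =
    (if t = 0 then \<psi> 0
     else (LINT s|lborel. exp (- s\<^sup>2 / (4 * t)) / sqrt (4 * pi * t) * \<psi> s))"

text \<open>
  Smoothness of \<open>F\<close> on an arbitrary subset \<open>X\<close> for the subset diffeology. A definition cannot
  quantify over the domain \<open>\<real>\<^sup>m\<close> of the plots \<open>p\<close>, so that domain is a type parameter;
  \<open>F\<close> is diffeologically smooth if this holds for every type \<open>'v\<close> of class
  \<^class>\<open>cartesian_space\<close>.
\<close>

definition diffeo_smooth_on ::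
    "'v::cartesian_space itself \<Rightarrow> 'a::real_normed_vector set \<Rightarrow>
     ('a \<Rightarrow> 'b::real_normed_vector) \<Rightarrow> bool"
  where "diffeo_smooth_on _ X F \<longleftrightarrow>
    (\<forall>(V :: 'v set) p. open V \<longrightarrow> smooth_on V p \<longrightarrow> p ` V \<subseteq> X \<longrightarrow> smooth_on V (F \<circ> p))"

end

theory Submission
  imports Defs "HOL-Probability.Distributions"
begin

text \<open>
  Pulling the test plot back along a plot \<open>(q, \<tau>)\<close> replaces it by the test plot
  \<open>\<psi> (v, x) = \<phi> (q v, x)\<close> on the domain \<open>V\<close> of \<open>(q, \<tau>)\<close>. The pairing
  \<open>\<langle>K(t), \<psi>(v, -)\<rangle>\<close> is continuous on \<open>V \<times> \<real>\<^sub>\<ge>\<^sub>0\<close> and solves the heat equation there, with a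
  one-sided derivative at \<open>t = 0\<close>. Hence \<open>v \<mapsto> \<langle>K(\<tau> v), \<psi>(v, -)\<rangle>\<close> is differentiable, and its
  derivative in direction \<open>h\<close> is \<open>\<langle>K(\<tau> v), \<partial>\<^sub>h \<psi> + d\<tau>(v)(h) \<partial>\<^sub>x\<^sup>2 \<psi>\<rangle>\<close>. The function paired with
  \<open>K(\<tau> v)\<close> is again a test plot on \<open>V\<close>, so \<open>C\<^sup>k\<close> for all test plots follows by induction on \<open>k\<close>.
  No smoothness of \<open>sqrt \<circ> \<tau>\<close>, which may fail where \<open>\<tau>\<close> vanishes, is needed.
\<close>

section \<open>Calculus of \<open>C\<^sup>k\<close> functions\<close>

text \<open>The chain rule below asks for a Cartesian intermediate space, and reparametrized test
  plots pass through \<open>'a \<times> real\<close>. The two bases, embedded along the axes, form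
  an orthonormal basis of the product.\<close>

instance prod :: (cartesian_space, cartesian_space) cartesian_space
proof
  from ex_orthonormal_basis[where 'a='a] obtain B :: "'a set" where B: "finite B" "\<forall>b\<in>B. \<forall>c\<in>B. inner b c = (if b = c then 1 else 0)"
      "\<forall>x. (\<forall>b\<in>B. inner x b = 0) \<longrightarrow> x = 0"
    by (elim exE conjE)
  from ex_orthonormal_basis[where 'a='b] obtain C :: "'b set" where C: "finite C" "\<forall>b\<in>C. \<forall>c\<in>C. inner b c = (if b = c then 1 else 0)"
      "\<forall>x. (\<forall>b\<in>C. inner x b = 0) \<longrightarrow> x = 0"
    by (elim exE conjE)
  \<comment> \<open>Basis vectors have norm one, hence are nonzero; this keeps \<open>(b, 0)\<close>
    and \<open>(0, c)\<close> distinct.\<close>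
  have nz: "0 \<notin> B" "0 \<notin> C"
    using B(2)[rule_format, of 0 0] C(2)[rule_format, of 0 0] by auto
  define D where "D = (\<lambda>b. (b, 0 :: 'b)) ` B \<union> (\<lambda>c. (0 :: 'a, c)) ` C"
  have D_iff: "d \<in> D \<longleftrightarrow> (\<exists>b\<in>B. d = (b, 0)) \<or> (\<exists>c\<in>C. d = (0, c))" for d
    by (auto simp: D_def)
  have "inner b c = (if b = c then 1 else 0)" if "b \<in> D" "c \<in> D" for b c
    using that nz unfolding D_iff by (auto simp: B(2) C(2) split: if_splits)
  moreover have "x = 0" if "\<forall>b\<in>D. inner x b = 0" for x
  proof -
    have "inner (fst x) b = 0" if "b \<in> B" for b
      using \<open>\<forall>b\<in>D. inner x b = 0\<close>[rule_format, of "(b, 0)"] that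
      by (simp add: D_iff inner_prod_def)
    moreover have "inner (snd x) c = 0" if "c \<in> C" for c
      using \<open>\<forall>b\<in>D. inner x b = 0\<close>[rule_format, of "(0, c)"] that
      by (simp add: D_iff inner_prod_def)
    ultimately show ?thesis
      using B(3) C(3) by (simp add: prod_eq_iff)
  qed
  moreover have "finite D"
    using B(1) C(1) by (simp add: D_def)
  ultimately show "\<exists>B::('a \<times> 'b) set. finite B \<and>
      (\<forall>b\<in>B. \<forall>c\<in>B. inner b c = (if b = c then 1 else 0)) \<and>
      (\<forall>x. (\<forall>b\<in>B. inner x b = 0) \<longrightarrow> x = 0)"
    by (intro exI[of _ D] conjI ballI allI impI)
qed

text \<open>The residual of \<open>x\<close> after projection is orthogonal to every vector of
  \<open>B\<close>, so it is zero. The expansion reduces questions about linear maps to finitely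
  many fixed directions.\<close>

lemma ex_finite_expansion:
  "\<exists>B :: 'a::cartesian_space set. finite B \<and> (\<forall>b\<in>B. norm b = 1) \<and> (\<forall>x. x = (\<Sum>b\<in>B. (x \<bullet> b) *\<^sub>R b))"
proof -
  from ex_orthonormal_basis[where 'a='a] obtain B :: "'a set" where B: "finite B" "\<forall>b\<in>B. \<forall>c\<in>B. inner b c = (if b = c then 1 else 0)"
      "\<forall>x. (\<forall>b\<in>B. inner x b = 0) \<longrightarrow> x = 0"
    by (elim exE conjE)
  have "x = (\<Sum>b\<in>B. (x \<bullet> b) *\<^sub>R b)" for x
  proof -
    have "(x - (\<Sum>b\<in>B. (x \<bullet> b) *\<^sub>R b)) \<bullet> c = 0" if "c \<in> B" for c
    proof -
      have "(\<Sum>b\<in>B. (x \<bullet> b) * (b \<bullet> c)) = (\<Sum>b\<in>B. if b = c then x \<bullet> b else 0)"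
        using B(2) that by (intro sum.cong) auto
      also have "\<dots> = x \<bullet> c"
        using B(1) that by simp
      finally show ?thesis
        by (simp add: inner_diff_left inner_sum_left)
    qed
    then show ?thesis
      using B(3)[rule_format, of "x - (\<Sum>b\<in>B. (x \<bullet> b) *\<^sub>R b)"] by simp
  qed
  moreover have "\<forall>b\<in>B. norm b = 1"
    using B(2) by (simp add: norm_eq_sqrt_inner)
  ultimately show ?thesis
    using B(1) by blast
qed

section \<open>Closure properties of C^k on open sets\<close>

lemma has_derivative_cong_open:
  assumes "open S" "x \<in> S" "\<And>y. y \<in> S \<Longrightarrow> f y = g y"
  shows "(f has_derivative D) (at x) \<longleftrightarrow> (g has_derivative D) (at x)"
proof
  assume "(f has_derivative D) (at x)"
  then show "(g has_derivative D) (at x)"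
    by (rule has_derivative_transform_within_open[OF _ assms])
next
  assume "(g has_derivative D) (at x)"
  then show "(f has_derivative D) (at x)"
    by (rule has_derivative_transform_within_open[OF _ assms(1,2)]) (simp add: assms(3))
qed

lemma frechet_derivative_cong_open:
  assumes "open S" "x \<in> S" "\<And>y. y \<in> S \<Longrightarrow> f y = g y"
  shows "frechet_derivative f (at x) = frechet_derivative g (at x)"
  unfolding frechet_derivative_def using has_derivative_cong_open[OF assms] by simp

lemma C_on_cong:
  assumes "open S" "\<And>x. x \<in> S \<Longrightarrow> f x = g x"
  shows "C_on k S f \<longleftrightarrow> C_on k S g"
  using assms(2)
proof (induction k arbitrary: f g)
  case 0
  then show ?case
    by (simp cong: continuous_on_cong)
next
  case (Suc k)
  have "C_on k S (\<lambda>x. frechet_derivative f (at x) v) \<longleftrightarrow> C_on k S (\<lambda>x. frechet_derivative g (at x) v)" for v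
    by (rule Suc.IH) (use frechet_derivative_cong_open[OF assms(1) _ Suc.prems] in simp)
  moreover have "f differentiable at x \<longleftrightarrow> g differentiable at x" if "x \<in> S" for x
    unfolding differentiable_def using has_derivative_cong_open[OF assms(1) that Suc.prems] by simp
  ultimately show ?case
    by simp
qed

text \<open>Derivatives are unique, so any explicit formula \<open>f'\<close> agrees on
  \<open>S\<close> with \<open>frechet_derivative f\<close>. Later inductions can thus work with
  whatever formula the differentiation rules produce.\<close>

lemma C_on_SucI:
  assumes "open S" "\<And>x. x \<in> S \<Longrightarrow> (f has_derivative f' x) (at x)" "\<And>v. C_on k S (\<lambda>x. f' x v)"
  shows "C_on (Suc k) S f"
proof -
  have "C_on k S (\<lambda>x. frechet_derivative f (at x) v)" for v
    by (rule C_on_cong[OF assms(1), THEN iffD1, OF _ assms(3)[of v]])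
       (simp add: frechet_derivative_at[OF assms(2)])
  then show ?thesis
    using assms(2) by (auto simp: differentiable_def)
qed

lemma C_on_SucD:
  assumes "C_on (Suc k) S f"
  shows "x \<in> S \<Longrightarrow> (f has_derivative frechet_derivative f (at x)) (at x)"
    and "C_on k S (\<lambda>x. frechet_derivative f (at x) v)"
  using assms by (auto simp: frechet_derivative_works)

text \<open>The recursion in \<open>C_on\<close> does not record lower orders, so they are recovered
  here: differentiability yields continuity at the base, and the induction hypothesis is applied to
  the directional derivatives.\<close>

lemma C_on_Suc_imp_C_on: "C_on (Suc k) S f \<Longrightarrow> C_on k S f"
proof (induction k arbitrary: f)
  case 0
  then show ?case
    by (auto intro!: continuous_at_imp_continuous_on differentiable_imp_continuous_within)
next
  case (Suc k)
  show ?case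
    unfolding C_on.simps(2)[of k]
    using Suc.prems Suc.IH[OF C_on_SucD(2)[OF Suc.prems]] by simp
qed

lemma C_on_const: "open S \<Longrightarrow> C_on k S (\<lambda>x. c)"
proof (induction k arbitrary: c)
  case (Suc k)
  show ?case
    by (rule C_on_SucI[where f' = "\<lambda>x v. 0"]) (use Suc in auto)
qed simp

lemma C_on_bounded_linear:
  assumes "open S" "bounded_linear L" "C_on k S f"
  shows "C_on k S (\<lambda>x. L (f x))"
  using assms(3)
proof (induction k arbitrary: f)
  case 0
  then show ?case
    using bounded_linear.continuous_on[OF assms(2)] by auto
next
  case (Suc k)
  show ?case
    by (rule C_on_SucI[OF assms(1) bounded_linear.has_derivative[OF assms(2) C_on_SucD(1)[OF Suc.prems]]
          Suc.IH[OF C_on_SucD(2)[OF Suc.prems]]])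
qed

lemma C_on_id: "open S \<Longrightarrow> C_on k S (\<lambda>x. x)"
proof (induction k)
  case (Suc k)
  show ?case
    by (rule C_on_SucI[where f' = "\<lambda>x v. v"]) (use Suc C_on_const in auto)
qed simp

lemma C_on_add:
  assumes "open S" "C_on k S f" "C_on k S g"
  shows "C_on k S (\<lambda>x. f x + g x)"
  using assms(2,3)
proof (induction k arbitrary: f g)
  case 0
  then show ?case
    by (auto intro: continuous_on_add)
next
  case (Suc k)
  show ?case
    by (rule C_on_SucI[OF assms(1) has_derivative_add[OF Suc.prems[THEN C_on_SucD(1)]]
          Suc.IH[OF Suc.prems[THEN C_on_SucD(2)]]])
qed

lemma C_on_sum:
  assumes "open S" "\<And>i. i \<in> I \<Longrightarrow> C_on k S (f i)"
  shows "C_on k S (\<lambda>x. \<Sum>i\<in>I. f i x)"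
  using assms(2)
  by (induction I rule: infinite_finite_induct)
     (auto simp: C_on_const assms(1) intro: C_on_add[OF assms(1)])

text \<open>By the Leibniz rule each summand of the derivative pairs a differentiated factor with an
  undifferentiated one; the latter is lowered by one order to match the induction
  hypothesis.\<close>

lemma C_on_bilinear:
  assumes "open S" "bounded_bilinear m" "C_on k S f" "C_on k S g"
  shows "C_on k S (\<lambda>x. m (f x) (g x))"
  using assms(3,4)
proof (induction k arbitrary: f g)
  case 0
  then show ?case
    using bounded_bilinear.continuous_on[OF assms(2)] by auto
next
  case (Suc k)
  show ?case
    by (rule C_on_SucI[OF assms(1) bounded_bilinear.FDERIV[OF assms(2) Suc.prems[THEN C_on_SucD(1)]]
          C_on_add[OF assms(1) Suc.IH Suc.IH]])
      (assumption | rule Suc.prems[THEN C_on_SucD(2)] Suc.prems[THEN C_on_Suc_imp_C_on])+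
qed

text \<open>In the chain rule the direction \<open>?g' x h\<close> moves with \<open>x\<close>,
  whereas \<open>C_on\<close> controls derivatives of \<open>f\<close> in fixed directions.
  Expanding it in an orthonormal basis gives a finite sum of products, to which the bilinear rule
  and the induction hypothesis apply.\<close>

lemma C_on_compose:
  fixes g :: "'a::real_normed_vector \<Rightarrow> 'b::cartesian_space"
  assumes "open S" "C_on k T f" "C_on k S g" "g ` S \<subseteq> T"
  shows "C_on k S (\<lambda>x. f (g x))"
  using assms(2,3)
proof (induction k arbitrary: f)
  case 0
  then show ?case
    using assms(4) by (auto intro: continuous_on_compose2)
next
  case (Suc k)
  obtain B :: "'b set" where B: "finite B" "\<And>x. x = (\<Sum>b\<in>B. (x \<bullet> b) *\<^sub>R b)"
    using ex_finite_expansion by metis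
  let ?f' = "\<lambda>y. frechet_derivative f (at y)" and ?g' = "\<lambda>x. frechet_derivative g (at x)"
  show ?case
  proof (rule C_on_SucI[OF assms(1)])
    fix x assume x: "x \<in> S"
    then have f': "(f has_derivative ?f' (g x)) (at (g x))"
      using assms(4) C_on_SucD(1)[OF Suc.prems(1)] by blast
    have "(\<lambda>h. ?f' (g x) (?g' x h)) = (\<lambda>h. \<Sum>b\<in>B. (?g' x h \<bullet> b) *\<^sub>R ?f' (g x) b)"
    proof
      fix h
      have "linear (?f' (g x))"
        using f' by (rule has_derivative_linear)
      then show "?f' (g x) (?g' x h) = (\<Sum>b\<in>B. (?g' x h \<bullet> b) *\<^sub>R ?f' (g x) b)"
        by (subst B(2)[of "?g' x h"]) (simp add: linear_sum linear_scale)
    qed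
    then show "((\<lambda>x. f (g x)) has_derivative (\<lambda>h. \<Sum>b\<in>B. (?g' x h \<bullet> b) *\<^sub>R ?f' (g x) b)) (at x)"
      using has_derivative_compose[OF C_on_SucD(1)[OF Suc.prems(2) x] f'] by simp
  next
    fix h
    show "C_on k S (\<lambda>x. \<Sum>b\<in>B. (?g' x h \<bullet> b) *\<^sub>R ?f' (g x) b)"
    proof (intro C_on_sum assms(1) C_on_bilinear[OF assms(1) bounded_bilinear_scaleR]
        C_on_bounded_linear[OF assms(1) bounded_linear_inner_left])
      show "C_on k S (\<lambda>x. ?g' x h)"
        by (rule C_on_SucD(2)[OF Suc.prems(2)])
      show "C_on k S (\<lambda>x. ?f' (g x) b)" for b
        by (rule Suc.IH[OF C_on_SucD(2)[OF Suc.prems(1)] C_on_Suc_imp_C_on[OF Suc.prems(2)]])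
    qed
  qed
qed

section \<open>Passage from C^k to smooth functions\<close>

lemma smooth_on_frechet_derivative:
  "smooth_on S f \<Longrightarrow> smooth_on S (\<lambda>x. frechet_derivative f (at x) v)"
  unfolding smooth_on_def by (intro allI C_on_SucD(2)) simp

lemma smooth_on_has_derivative:
  "smooth_on S f \<Longrightarrow> x \<in> S \<Longrightarrow> (f has_derivative frechet_derivative f (at x)) (at x)"
  unfolding smooth_on_def by (rule C_on_SucD(1)[of 0]) auto

lemma smooth_on_continuous_on: "smooth_on S f \<Longrightarrow> continuous_on S f"
  unfolding smooth_on_def by (metis C_on.simps(1))

lemma smooth_on_bounded_linear:
  "open S \<Longrightarrow> bounded_linear L \<Longrightarrow> smooth_on S f \<Longrightarrow> smooth_on S (\<lambda>x. L (f x))"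
  by (simp add: smooth_on_def C_on_bounded_linear)

lemma smooth_on_linear: "open S \<Longrightarrow> bounded_linear L \<Longrightarrow> smooth_on S L"
  using smooth_on_bounded_linear[of S L "\<lambda>x. x"] by (simp add: smooth_on_def C_on_id)

lemma smooth_on_add:
  "open S \<Longrightarrow> smooth_on S f \<Longrightarrow> smooth_on S g \<Longrightarrow> smooth_on S (\<lambda>x. f x + g x)"
  by (simp add: smooth_on_def C_on_add)

lemma smooth_on_mult:
  fixes f g :: "'a::real_normed_vector \<Rightarrow> 'b::real_normed_algebra"
  shows "open S \<Longrightarrow> smooth_on S f \<Longrightarrow> smooth_on S g \<Longrightarrow> smooth_on S (\<lambda>x. f x * g x)"
  by (simp add: smooth_on_def C_on_bilinear[OF _ bounded_bilinear_mult])

lemma smooth_on_compose: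
  fixes g :: "'a::real_normed_vector \<Rightarrow> 'b::cartesian_space"
  shows "open S \<Longrightarrow> smooth_on T f \<Longrightarrow> smooth_on S g \<Longrightarrow> g ` S \<subseteq> T \<Longrightarrow> smooth_on S (\<lambda>x. f (g x))"
  unfolding smooth_on_def by (blast intro: C_on_compose)

section \<open>Test plots\<close>

text \<open>With the direction as first argument, \<open>dir_deriv v\<close> is an operator on
  functions and can be iterated: \<open>dir_deriv (0, 1) (dir_deriv (0, 1) \<phi>)\<close> is the
  second derivative in the real variable.\<close>

definition dir_deriv :: "'a::real_normed_vector \<Rightarrow> ('a \<Rightarrow> 'b::real_normed_vector) \<Rightarrow> 'a \<Rightarrow> 'b"
  where "dir_deriv v f x = frechet_derivative f (at x) v"

lemma smooth_on_dir_deriv: "smooth_on S f \<Longrightarrow> smooth_on S (dir_deriv v f)"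
  using smooth_on_frechet_derivative[of S f v] by (simp add: dir_deriv_def[abs_def])

lemma smooth_on_has_dir_deriv:
  "smooth_on S f \<Longrightarrow> x \<in> S \<Longrightarrow> (f has_derivative (\<lambda>v. dir_deriv v f x)) (at x)"
  using smooth_on_has_derivative[of S f x] by (simp add: dir_deriv_def[abs_def])

lemma smooth_on_compose_fst:
  fixes g :: "'a::cartesian_space \<Rightarrow> 'b::real_normed_vector"
  assumes "open U" "smooth_on U g"
  shows "smooth_on (U \<times> (UNIV :: real set)) (\<lambda>z. g (fst z))"
  by (rule smooth_on_compose[OF _ assms(2)])
     (auto intro!: open_Times assms(1) smooth_on_linear bounded_linear_fst)

section \<open>Support conditions and operations on test plots\<close>

text \<open>A suitable cover amounts to one good neighbourhood per point; in this form the condition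
  can be intersected and pulled back pointwise.\<close>

lemma locally_unif_bounded_support_iff:
  "locally_unif_bounded_support U \<phi> \<longleftrightarrow>
    (\<forall>u\<in>U. \<exists>W b. open W \<and> u \<in> W \<and> W \<subseteq> U \<and> (\<forall>w\<in>W. \<forall>x. \<bar>x\<bar> > b \<longrightarrow> \<phi> (w, x) = 0))"
proof
  assume "locally_unif_bounded_support U \<phi>"
  then obtain \<C> where \<C>: "\<forall>W\<in>\<C>. open W \<and> W \<subseteq> U" "U \<subseteq> \<Union>\<C>"
      "\<forall>W\<in>\<C>. \<exists>b::real. \<forall>u\<in>W. \<forall>x. \<bar>x\<bar> > b \<longrightarrow> \<phi> (u, x) = 0"
    unfolding locally_unif_bounded_support_def by (elim exE conjE)
  show "\<forall>u\<in>U. \<exists>W b. open W \<and> u \<in> W \<and> W \<subseteq> U \<and> (\<forall>w\<in>W. \<forall>x. \<bar>x\<bar> > b \<longrightarrow> \<phi> (w, x) = 0)"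
  proof
    fix u assume "u \<in> U"
    then obtain W where "W \<in> \<C>" "u \<in> W"
      using \<C>(2) by auto
    then show "\<exists>W b. open W \<and> u \<in> W \<and> W \<subseteq> U \<and> (\<forall>w\<in>W. \<forall>x. \<bar>x\<bar> > b \<longrightarrow> \<phi> (w, x) = 0)"
      using \<C>(1,3) by (intro exI[of _ W]) simp
  qed
next
  assume *: "\<forall>u\<in>U. \<exists>W b. open W \<and> u \<in> W \<and> W \<subseteq> U \<and> (\<forall>w\<in>W. \<forall>x. \<bar>x\<bar> > b \<longrightarrow> \<phi> (w, x) = 0)"
  show "locally_unif_bounded_support U \<phi>"
    unfolding locally_unif_bounded_support_def
    by (rule exI[of _ "{W. open W \<and> W \<subseteq> U \<and> (\<exists>b. \<forall>w\<in>W. \<forall>x. \<bar>x\<bar> > b \<longrightarrow> \<phi> (w, x) = 0)}"])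
       (use * in \<open>simp add: subset_iff; metis\<close>)
qed

lemma test_plotI:
  assumes "smooth_on (U \<times> UNIV) \<phi>"
    and "\<And>u. u \<in> U \<Longrightarrow>
      \<exists>W b. open W \<and> u \<in> W \<and> W \<subseteq> U \<and> (\<forall>w\<in>W. \<forall>x. \<bar>x\<bar> > b \<longrightarrow> \<phi> (w, x) = 0)"
  shows "test_plot U \<phi>"
  using assms unfolding test_plot_def locally_unif_bounded_support_iff by simp

lemma test_plotD_smooth: "test_plot U \<phi> \<Longrightarrow> smooth_on (U \<times> UNIV) \<phi>"
  by (simp add: test_plot_def)

lemma test_plotE:
  assumes "test_plot U \<phi>" "u \<in> U"
  obtains W b where "open W" "u \<in> W" "W \<subseteq> U" "\<forall>w\<in>W. \<forall>x. \<bar>x\<bar> > b \<longrightarrow> \<phi> (w, x) = 0"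
proof -
  have "\<exists>W b. open W \<and> u \<in> W \<and> W \<subseteq> U \<and> (\<forall>w\<in>W. \<forall>x. \<bar>x\<bar> > b \<longrightarrow> \<phi> (w, x) = 0)"
    using assms unfolding test_plot_def locally_unif_bounded_support_iff by simp
  then show ?thesis
    using that by (elim exE conjE) blast
qed

lemma test_plot_add:
  assumes "open U" "test_plot U \<phi>" "test_plot U \<psi>"
  shows "test_plot U (\<lambda>z. \<phi> z + \<psi> z)"
proof (rule test_plotI)
  show "smooth_on (U \<times> UNIV) (\<lambda>z. \<phi> z + \<psi> z)"
    using assms by (intro smooth_on_add test_plotD_smooth open_Times) auto
next
  fix u assume "u \<in> U"
  obtain W b where W: "open W" "u \<in> W" "W \<subseteq> U" "\<forall>w\<in>W. \<forall>x. \<bar>x\<bar> > b \<longrightarrow> \<phi> (w, x) = 0"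
    by (rule test_plotE[OF assms(2) \<open>u \<in> U\<close>])
  obtain W' b' where W': "open W'" "u \<in> W'" "W' \<subseteq> U" "\<forall>w\<in>W'. \<forall>x. \<bar>x\<bar> > b' \<longrightarrow> \<psi> (w, x) = 0"
    by (rule test_plotE[OF assms(3) \<open>u \<in> U\<close>])
  show "\<exists>W b. open W \<and> u \<in> W \<and> W \<subseteq> U \<and> (\<forall>w\<in>W. \<forall>x. \<bar>x\<bar> > b \<longrightarrow> \<phi> (w, x) + \<psi> (w, x) = 0)"
    using W W' by (intro exI[of _ "W \<inter> W'"] exI[of _ "max b b'"]) auto
qed

lemma test_plot_mult:
  fixes U :: "'a::cartesian_space set"
  assumes "open U" "smooth_on U g" "test_plot U \<phi>"
  shows "test_plot U (\<lambda>z. g (fst z) * \<phi> z)"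
proof (rule test_plotI)
  show "smooth_on (U \<times> UNIV) (\<lambda>z. g (fst z) * \<phi> z)"
    using assms by (intro smooth_on_mult smooth_on_compose_fst test_plotD_smooth open_Times) auto
next
  fix u assume "u \<in> U"
  obtain W b where W: "open W" "u \<in> W" "W \<subseteq> U" "\<forall>w\<in>W. \<forall>x. \<bar>x\<bar> > b \<longrightarrow> \<phi> (w, x) = 0"
    by (rule test_plotE[OF assms(3) \<open>u \<in> U\<close>])
  then show "\<exists>W b. open W \<and> u \<in> W \<and> W \<subseteq> U \<and>
      (\<forall>w\<in>W. \<forall>x. \<bar>x\<bar> > b \<longrightarrow> g (fst (w, x)) * \<phi> (w, x) = 0)"
    by (intro exI[of _ W] exI[of _ b]) simp
qed

text \<open>The bound \<open>b\<close> is inherited: the strict inequality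
  \<open>\<bar>x\<bar> > b\<close> cuts out an open set on which \<open>\<phi>\<close> is zero, so
  its derivative is zero there too.\<close>

lemma test_plot_dir_deriv:
  assumes "test_plot U \<phi>"
  shows "test_plot U (dir_deriv v \<phi>)"
proof (rule test_plotI)
  show "smooth_on (U \<times> UNIV) (dir_deriv v \<phi>)"
    by (rule smooth_on_dir_deriv[OF test_plotD_smooth[OF assms]])
next
  fix u assume "u \<in> U"
  obtain W b where W: "open W" "u \<in> W" "W \<subseteq> U" "\<forall>w\<in>W. \<forall>x. \<bar>x\<bar> > b \<longrightarrow> \<phi> (w, x) = 0"
    by (rule test_plotE[OF assms \<open>u \<in> U\<close>])
  have "dir_deriv v \<phi> (w, x) = 0" if "w \<in> W" "\<bar>x\<bar> > b" for w x
  proof -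
    have "open (W \<times> {x. \<bar>x\<bar> > b})"
      by (intro open_Times W(1) open_Collect_less continuous_intros)
    then have "frechet_derivative \<phi> (at (w, x)) = frechet_derivative (\<lambda>z. 0) (at (w, x))"
      by (rule frechet_derivative_cong_open) (use that W(4) in auto)
    then show ?thesis
      by (simp add: dir_deriv_def)
  qed
  with W show "\<exists>W b. open W \<and> u \<in> W \<and> W \<subseteq> U \<and> (\<forall>w\<in>W. \<forall>x. \<bar>x\<bar> > b \<longrightarrow> dir_deriv v \<phi> (w, x) = 0)"
    by (intro exI[of _ W] exI[of _ b]) simp
qed

text \<open>Support bounds near \<open>q v\<close> are pulled back along the continuous map
  \<open>q\<close>. This exchanges a plot in \<open>U\<close> for a test plot on the domain of that
  plot.\<close>

lemma test_plot_reparametrize: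
  fixes V :: "'v::cartesian_space set" and U :: "'a::cartesian_space set"
  assumes "open V" "smooth_on V q" "q ` V \<subseteq> U" "test_plot U \<phi>"
  shows "test_plot V (\<lambda>z. \<phi> (q (fst z), snd z))"
proof (rule test_plotI)
  \<comment> \<open>The pair is split into its two axis components, each a linear image of a smooth
    map.\<close>
  have "smooth_on (V \<times> UNIV) (\<lambda>z. (q (fst z), 0) + (0, snd z) :: 'a \<times> real)"
    by (intro smooth_on_add open_Times assms(1) open_UNIV
        smooth_on_bounded_linear[OF _ bounded_linear_Pair[OF bounded_linear_ident bounded_linear_zero]]
        smooth_on_linear[OF _ bounded_linear_Pair[OF bounded_linear_zero bounded_linear_snd]]
        smooth_on_compose_fst assms(2))
  then have "smooth_on (V \<times> UNIV) (\<lambda>z. (q (fst z), snd z) :: 'a \<times> real)"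
    by simp
  from smooth_on_compose[OF _ test_plotD_smooth[OF assms(4)] this]
  show "smooth_on (V \<times> UNIV) (\<lambda>z. \<phi> (q (fst z), snd z))"
    using assms(1,3) by (force intro: open_Times)
next
  fix v assume "v \<in> V"
  then have "q v \<in> U"
    using assms(3) by auto
  then obtain W b where W: "open W" "q v \<in> W" "W \<subseteq> U" "\<forall>w\<in>W. \<forall>x. \<bar>x\<bar> > b \<longrightarrow> \<phi> (w, x) = 0"
    by (rule test_plotE[OF assms(4)])
  have "open (q -` W \<inter> V)"
    using continuous_on_open_vimage[OF assms(1), of q] smooth_on_continuous_on[OF assms(2)] W(1) by simp
  with W \<open>v \<in> V\<close> show "\<exists>W b. open W \<and> v \<in> W \<and> W \<subseteq> V \<and>
      (\<forall>w\<in>W. \<forall>x. \<bar>x\<bar> > b \<longrightarrow> \<phi> (q (fst (w, x)), snd (w, x)) = 0)"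
    by (intro exI[of _ "q -` W \<inter> V"] exI[of _ b]) simp
qed

section \<open>Partial derivatives and bounds uniform in the real variable\<close>

text \<open>Compactness of \<open>{-b..b}\<close> bounds \<open>\<phi>\<close> at the single
  parameter \<open>u\<close>; the tube lemma spreads the bound to a neighbourhood of
  \<open>u\<close>, and outside \<open>{-b..b}\<close> the function vanishes.\<close>

lemma test_plot_locally_bounded:
  assumes "open U" "test_plot U \<phi>" "u \<in> U"
  obtains W M where "open W" "u \<in> W" "W \<subseteq> U" "\<forall>w\<in>W. \<forall>x. \<bar>\<phi> (w, x)\<bar> \<le> M"
proof -
  obtain W b where W: "open W" "u \<in> W" "W \<subseteq> U" "\<forall>w\<in>W. \<forall>x. \<bar>x\<bar> > b \<longrightarrow> \<phi> (w, x) = 0"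
    by (rule test_plotE[OF assms(2,3)])
  have cont: "continuous_on (W \<times> UNIV) \<phi>"
    using smooth_on_continuous_on[OF test_plotD_smooth[OF assms(2)]]
    by (rule continuous_on_subset) (use W(3) in auto)
  have "continuous_on {-b..b} (\<lambda>x. \<phi> (u, x))"
    by (rule continuous_on_compose2[OF cont]) (auto intro!: continuous_intros simp: W(2))
  then have "bounded ((\<lambda>x. \<phi> (u, x)) ` {-b..b})"
    by (intro compact_imp_bounded compact_continuous_image) auto
  then obtain M where M: "0 < M" "\<And>x. x \<in> {-b..b} \<Longrightarrow> \<bar>\<phi> (u, x)\<bar> \<le> M"
    unfolding bounded_pos by auto
  \<comment> \<open>The slack from \<open>M\<close> to \<open>M + 1\<close> turns the closed bound
    into an open condition that holds on all of \<open>{u} \<times> {-b..b}\<close>.\<close>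
  have "open (\<phi> -` {-(M + 1)<..<M + 1} \<inter> W \<times> UNIV)"
    using continuous_on_open_vimage[of "W \<times> UNIV" \<phi>] cont W(1) by (simp add: open_Times)
  moreover have "{u} \<times> {-b..b} \<subseteq> \<phi> -` {-(M + 1)<..<M + 1} \<inter> W \<times> UNIV"
    using M(2) W(2) by (fastforce simp: abs_le_iff)
  ultimately have "\<exists>X Y. open X \<and> open Y \<and> u \<in> X \<and> {-b..b} \<subseteq> Y \<and>
      X \<times> Y \<subseteq> \<phi> -` {-(M + 1)<..<M + 1} \<inter> W \<times> UNIV"
    using tube_lemma_right[of euclidean euclidean "\<phi> -` {-(M + 1)<..<M + 1} \<inter> W \<times> UNIV" "{-b..b}" u]
    unfolding prod_topology_euclidean open_openin[symmetric] compactin_euclidean_iff by simp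
  then obtain X where X: "u \<in> X" "open X" "X \<times> {-b..b} \<subseteq> \<phi> -` {-(M + 1)<..<M + 1}"
    by blast
  have "\<bar>\<phi> (w, x)\<bar> \<le> M + 1" if "w \<in> X \<inter> W" for w x
  proof (cases "\<bar>x\<bar> > b")
    case True
    then show ?thesis
      using W(4) that M(1) by simp
  next
    case False
    then have "(w, x) \<in> \<phi> -` {-(M + 1)<..<M + 1}"
      using that by (intro subsetD[OF X(3)]) auto
    then show ?thesis
      by (simp add: abs_le_iff)
  qed
  then show ?thesis
    by (intro that[of "X \<inter> W" "M + 1"]) (use X W in auto)
qed

lemma test_plot_has_derivative_snd:
  assumes "test_plot U \<phi>" "u \<in> U"
  shows "((\<lambda>x. \<phi> (u, x)) has_real_derivative dir_deriv (0, 1) \<phi> (u, x)) (at x)"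
proof -
  have D: "(\<phi> has_derivative (\<lambda>v. dir_deriv v \<phi> (u, x))) (at (u, x))"
    by (rule smooth_on_has_dir_deriv[OF test_plotD_smooth[OF assms(1)]]) (use assms(2) in simp)
  have "((\<lambda>x. (u, x)) has_derivative (\<lambda>h. (0, h))) (at x)"
    by (intro derivative_eq_intros) auto
  from has_derivative_compose[OF this D]
  have "((\<lambda>x. \<phi> (u, x)) has_derivative (\<lambda>h. dir_deriv (0, h) \<phi> (u, x))) (at x)" .
  moreover have "(\<lambda>h. dir_deriv (0, h) \<phi> (u, x)) = (*) (dir_deriv (0, 1) \<phi> (u, x))"
  proof
    show "dir_deriv (0, h) \<phi> (u, x) = dir_deriv (0, 1) \<phi> (u, x) * h" for h
      using linear_scale[OF has_derivative_linear[OF D], of h "(0, 1)"] by simp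
  qed
  ultimately show ?thesis
    unfolding has_field_derivative_def by simp
qed

lemma test_plot_has_derivative_fst:
  assumes "test_plot U \<phi>" "u \<in> U"
  shows "((\<lambda>u. \<phi> (u, x)) has_derivative (\<lambda>h. dir_deriv (h, 0) \<phi> (u, x))) (at u)"
proof -
  have D: "(\<phi> has_derivative (\<lambda>v. dir_deriv v \<phi> (u, x))) (at (u, x))"
    by (rule smooth_on_has_dir_deriv[OF test_plotD_smooth[OF assms(1)]]) (use assms(2) in simp)
  have "((\<lambda>u. (u, x)) has_derivative (\<lambda>h. (h, 0))) (at u)"
    by (intro derivative_eq_intros) auto
  from has_derivative_compose[OF this D] show ?thesis .
qed

lemma test_plot_continuous_on_snd:
  assumes "test_plot U \<phi>" "u \<in> U"
  shows "continuous_on S (\<lambda>x. \<phi> (u, x))"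
  by (intro continuous_at_imp_continuous_on ballI DERIV_isCont[OF test_plot_has_derivative_snd[OF assms]])

lemma test_plot_measurable:
  assumes "test_plot U \<phi>" "u \<in> U"
  shows "(\<lambda>x. \<phi> (u, x)) \<in> borel_measurable borel"
  by (intro borel_measurable_continuous_onI test_plot_continuous_on_snd[OF assms])

lemma test_plot_bounded:
  assumes "open U" "test_plot U \<phi>" "u \<in> U"
  obtains M where "\<forall>x. \<bar>\<phi> (u, x)\<bar> \<le> M"
  using test_plot_locally_bounded[OF assms] by metis

text \<open>The derivative along \<open>h\<close> combines those in finitely many basis directions,
  each bounded near \<open>u\<close> uniformly in \<open>x\<close>; the mean value inequality on a
  ball converts this into a Lipschitz bound. That \<open>L\<close> is independent of
  \<open>x\<close> is what domination under the integral requires.\<close>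

lemma test_plot_locally_lipschitz:
  fixes U :: "'a::cartesian_space set"
  assumes "open U" "test_plot U \<phi>" "u \<in> U"
  obtains r L where "r > 0" "ball u r \<subseteq> U"
    "\<And>w x. w \<in> ball u r \<Longrightarrow> \<bar>\<phi> (w, x) - \<phi> (u, x)\<bar> \<le> L * norm (w - u)"
    "\<And>h x. \<bar>dir_deriv (h, 0) \<phi> (u, x)\<bar> \<le> L * norm h"
proof -
  obtain B :: "'a set" where B: "finite B" "\<And>b. b \<in> B \<Longrightarrow> norm b = 1" "\<And>x. x = (\<Sum>b\<in>B. (x \<bullet> b) *\<^sub>R b)"
    using ex_finite_expansion[where 'a='a] by (elim exE conjE) blast
  have "\<exists>W M. open W \<and> u \<in> W \<and> W \<subseteq> U \<and> (\<forall>w\<in>W. \<forall>x. \<bar>dir_deriv (b, 0) \<phi> (w, x)\<bar> \<le> M)" for b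
    using test_plot_locally_bounded[OF assms(1) test_plot_dir_deriv[OF assms(2)] assms(3), of "(b, 0)"]
    by metis
  then obtain W M where W: "\<And>b. open (W b)" "\<And>b. u \<in> W b" "\<And>b. W b \<subseteq> U"
      "\<And>b w x. w \<in> W b \<Longrightarrow> \<bar>dir_deriv (b, 0) \<phi> (w, x)\<bar> \<le> M b"
    by metis
  \<comment> \<open>Each coordinate \<open>h \<bullet> b\<close> is at most \<open>norm h\<close> in
    absolute value, as \<open>b\<close> is a unit vector, so the bounds \<open>M b\<close> add
    up.\<close>
  define L where "L = (\<Sum>b\<in>B. M b)"
  have "L \<ge> 0"
    unfolding L_def by (intro sum_nonneg order_trans[OF abs_ge_zero W(4)[OF W(2)]])
  have "open (U \<inter> (\<Inter>b\<in>B. W b))"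
    using B(1) W(1) assms(1) by (intro open_Int open_INT) auto
  moreover have "u \<in> U \<inter> (\<Inter>b\<in>B. W b)"
    using W(2) assms(3) by simp
  ultimately obtain r where r: "r > 0" "ball u r \<subseteq> U \<inter> (\<Inter>b\<in>B. W b)"
    unfolding open_contains_ball by blast
  have bound: "\<bar>dir_deriv (h, 0) \<phi> (w, x)\<bar> \<le> L * norm h" if "w \<in> ball u r" for w x h
  proof -
    have "w \<in> U"
      using that r(2) by auto
    then have lin: "linear (\<lambda>h. dir_deriv (h, 0) \<phi> (w, x))"
      by (rule has_derivative_linear[OF test_plot_has_derivative_fst[OF assms(2)]])
    have "dir_deriv (h, 0) \<phi> (w, x) = dir_deriv (\<Sum>b\<in>B. (h \<bullet> b) *\<^sub>R b, 0) \<phi> (w, x)"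
      using B(3)[of h] by simp
    also have "\<dots> = (\<Sum>b\<in>B. (h \<bullet> b) * dir_deriv (b, 0) \<phi> (w, x))"
      using linear_sum[OF lin, of "\<lambda>b. (h \<bullet> b) *\<^sub>R b" B] linear_scale[OF lin] by simp
    also have "\<bar>\<dots>\<bar> \<le> (\<Sum>b\<in>B. norm h * M b)"
    proof (rule order_trans[OF sum_abs sum_mono])
      fix b assume "b \<in> B"
      then have "\<bar>h \<bullet> b\<bar> \<le> norm h" "\<bar>dir_deriv (b, 0) \<phi> (w, x)\<bar> \<le> M b"
        using Cauchy_Schwarz_ineq2[of h b] B(2) W(4) r(2) that by auto
      then show "\<bar>(h \<bullet> b) * dir_deriv (b, 0) \<phi> (w, x)\<bar> \<le> norm h * M b"
        unfolding abs_mult by (intro mult_mono) auto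
    qed
    finally show ?thesis
      by (simp add: L_def sum_distrib_left mult.commute)
  qed
  have "norm (\<phi> (w, x) - \<phi> (u, x)) \<le> L * norm (w - u)" if "w \<in> ball u r" for w x
  proof (rule differentiable_bound[where S = "ball u r" and f = "\<lambda>w. \<phi> (w, x)"])
    show "((\<lambda>w. \<phi> (w, x)) has_derivative (\<lambda>h. dir_deriv (h, 0) \<phi> (z, x))) (at z within ball u r)"
      if "z \<in> ball u r" for z
      by (rule has_derivative_at_withinI[OF test_plot_has_derivative_fst[OF assms(2)]]) (use that r(2) in blast)
    show "onorm (\<lambda>h. dir_deriv (h, 0) \<phi> (z, x)) \<le> L" if "z \<in> ball u r" for z
      by (rule onorm_bound[OF \<open>L \<ge> 0\<close>]) (simp add: bound[OF that])
    show "w \<in> ball u r" "u \<in> ball u r" "convex (ball u r)"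
      using that r(1) by simp_all
  qed
  then show ?thesis
    using r bound[of u] by (intro that[of r L]) simp_all
qed

section \<open>Dominated convergence and Gaussian means\<close>

text \<open>First countability of the parameter space makes sequences sufficient, and along a
  sequence the classical dominated convergence theorem applies.\<close>

lemma tendsto_integral_dominated:
  fixes f :: "'z::first_countable_topology \<Rightarrow> 'y \<Rightarrow> real"
  assumes meas: "\<forall>\<^sub>F z in at z0 within S. f z \<in> borel_measurable M" "g \<in> borel_measurable M"
    and w: "integrable M w"
    and bound: "\<forall>\<^sub>F z in at z0 within S. \<forall>y. \<bar>f z y\<bar> \<le> w y"
    and lim: "\<And>y. ((\<lambda>z. f z y) \<longlongrightarrow> g y) (at z0 within S)"
  shows "((\<lambda>z. LINT y|M. f z y) \<longlongrightarrow> (LINT y|M. g y)) (at z0 within S)"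
  unfolding tendsto_at_iff_sequentially
proof (intro allI impI)
  fix X assume "\<forall>i. X i \<in> S - {z0}" "X \<longlonglongrightarrow> z0"
  then have X: "filterlim X (at z0 within S) sequentially"
    by (auto simp: filterlim_at)
  have "\<forall>\<^sub>F i in sequentially. f (X i) \<in> borel_measurable M \<and> (\<forall>y. \<bar>f (X i) y\<bar> \<le> w y)"
    using eventually_compose_filterlim[OF eventually_conj[OF meas(1) bound] X] by simp
  \<comment> \<open>Measurability and domination are known only near \<open>z0\<close>, so the first
    \<open>N\<close> terms of the sequence are discarded.\<close>
  then obtain N where N: "\<And>i. i \<ge> N \<Longrightarrow> f (X i) \<in> borel_measurable M \<and> (\<forall>y. \<bar>f (X i) y\<bar> \<le> w y)"
    unfolding eventually_sequentially by blast
  have "(\<lambda>i. LINT y|M. f (X (i + N)) y) \<longlonglongrightarrow> (LINT y|M. g y)"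
  proof (rule integral_dominated_convergence[OF meas(2) _ w])
    show "f (X (i + N)) \<in> borel_measurable M" for i
      using N[of "i + N"] by simp
    show "AE y in M. norm (f (X (i + N)) y) \<le> w y" for i
      using N[of "i + N"] by simp
    have "(\<lambda>i. f (X (i + N)) y) \<longlonglongrightarrow> g y" for y
      using LIMSEQ_ignore_initial_segment[OF filterlim_compose[OF lim X]] .
    then show "AE y in M. (\<lambda>i. f (X (i + N)) y) \<longlonglongrightarrow> g y"
      by simp
  qed
  then show "((\<lambda>z. LINT y|M. f z y) \<circ> X) \<longlonglongrightarrow> (LINT y|M. g y)"
    unfolding comp_def by (rule LIMSEQ_offset)
qed

text \<open>Dominated convergence is applied to the first-order remainder divided by
  \<open>norm (z - z0)\<close>, which tends to zero pointwise by differentiability.\<close>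

lemma has_derivative_integral_dominated:
  fixes f :: "'z::real_normed_vector \<Rightarrow> 'y \<Rightarrow> real"
  assumes meas: "\<forall>\<^sub>F z in at z0. f z \<in> borel_measurable M" "\<And>h. (\<lambda>y. f' y h) \<in> borel_measurable M"
    and int: "integrable M (f z0)" "integrable M w"
    and lip: "\<forall>\<^sub>F z in at z0. \<forall>y. \<bar>f z y - f z0 y\<bar> \<le> w y * norm (z - z0)"
    and bound: "\<And>y h. \<bar>f' y h\<bar> \<le> w y * norm h"
    and der: "\<And>y. ((\<lambda>z. f z y) has_derivative f' y) (at z0)"
  shows "((\<lambda>z. LINT y|M. f z y) has_derivative (\<lambda>h. LINT y|M. f' y h)) (at z0)"
proof -
  have lin: "bounded_linear (f' y)" for y
    by (rule has_derivative_bounded_linear[OF der])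
  have int_wn: "integrable M (\<lambda>y. w y * c)" for c
    using int(2) by simp
  have int_f': "integrable M (\<lambda>y. f' y h)" for h
    by (rule Bochner_Integration.integrable_bound[OF int_wn[of "norm h"] meas(2)])
       (auto intro!: AE_I2 order_trans[OF bound])
  have "bounded_linear (\<lambda>h. LINT y|M. f' y h)"
  proof (rule bounded_linear_intro)
    show "(LINT y|M. f' y (a + b)) = (LINT y|M. f' y a) + (LINT y|M. f' y b)" for a b
      using int_f' by (simp add: linear_simps[OF lin])
    show "(LINT y|M. f' y (r *\<^sub>R a)) = r *\<^sub>R (LINT y|M. f' y a)" for r a
      using int_f' by (simp add: linear_simps[OF lin])
    show "norm (LINT y|M. f' y h) \<le> norm h * (LINT y|M. w y)" for h
    proof -
      have "norm (LINT y|M. f' y h) \<le> (LINT y|M. w y * norm h)"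
        by (rule order_trans[OF integral_norm_bound Bochner_Integration.integral_mono])
           (use bound in \<open>simp_all add: int_f' int(2)\<close>)
      then show ?thesis
        by (simp add: mult.commute)
    qed
  qed
  moreover have "((\<lambda>z. ((LINT y|M. f z y) - (LINT y|M. f z0 y) - (LINT y|M. f' y (z - z0))) /\<^sub>R norm (z - z0)) \<longlongrightarrow> 0) (at z0)"
  proof -
    have ev: "\<forall>\<^sub>F z in at z0. z \<noteq> z0 \<and> f z \<in> borel_measurable M \<and>
        (\<forall>y. \<bar>f z y - f z0 y\<bar> \<le> w y * norm (z - z0))"
      using meas(1) lip eventually_neq_at_within[of z0 z0 UNIV] by eventually_elim auto
    have [measurable]: "f z0 \<in> borel_measurable M"
      using int(1) by simp
    note meas(2)[measurable]
    have "((\<lambda>z. LINT y|M. (f z y - f z0 y - f' y (z - z0)) /\<^sub>R norm (z - z0)) \<longlongrightarrow> (LINT y|M. 0)) (at z0)"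
    \<comment> \<open>One copy of \<open>w\<close> bounds the difference quotient, the other the
      linear term.\<close>
    proof (rule tendsto_integral_dominated[where w = "\<lambda>y. w y * 2"])
      show "\<forall>\<^sub>F z in at z0. (\<lambda>y. (f z y - f z0 y - f' y (z - z0)) /\<^sub>R norm (z - z0)) \<in> borel_measurable M"
        using meas(1)
      proof eventually_elim
        case (elim z)
        note elim[measurable]
        show ?case
          by measurable
      qed
      show "\<forall>\<^sub>F z in at z0. \<forall>y. \<bar>(f z y - f z0 y - f' y (z - z0)) /\<^sub>R norm (z - z0)\<bar> \<le> w y * 2"
        using ev
      proof eventually_elim
        case (elim z)
        then have "norm (z - z0) > 0"
          by simp
        moreover have "\<bar>f z y - f z0 y - f' y (z - z0)\<bar> \<le> w y * norm (z - z0) + w y * norm (z - z0)" for y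
          using elim bound[of y "z - z0"] by (intro order_trans[OF abs_triangle_ineq4 add_mono]) auto
        ultimately show ?case
          by (simp add: abs_mult field_simps)
      qed
      show "((\<lambda>z. (f z y - f z0 y - f' y (z - z0)) /\<^sub>R norm (z - z0)) \<longlongrightarrow> 0) (at z0)" for y
        using der[of y] unfolding has_derivative_at_within by simp
    qed (use int_wn in auto)
    moreover have "\<forall>\<^sub>F z in at z0. (LINT y|M. (f z y - f z0 y - f' y (z - z0)) /\<^sub>R norm (z - z0)) =
        ((LINT y|M. f z y) - (LINT y|M. f z0 y) - (LINT y|M. f' y (z - z0))) /\<^sub>R norm (z - z0)"
      using ev
    proof eventually_elim
      case (elim z)
      then have [measurable]: "f z \<in> borel_measurable M"
        by simp
      \<comment> \<open>Integrability is assumed at \<open>z0\<close>; the Lipschitz bound transfers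
        it to nearby \<open>z\<close>, which permits splitting the integral of the
        remainder.\<close>
      have "norm (f z y - f z0 y) \<le> norm (w y * norm (z - z0))" for y
        using elim abs_ge_self[of "w y * norm (z - z0)"] by (auto intro: order_trans)
      then have "integrable M (\<lambda>y. f z y - f z0 y)"
        by (intro Bochner_Integration.integrable_bound[OF int_wn[of "norm (z - z0)"]] AE_I2) auto
      from Bochner_Integration.integrable_add[OF this int(1)] have "integrable M (f z)"
        by simp
      then show ?case
        using int(1) int_f' by simp
    qed
    ultimately show ?thesis
      by (subst (asm) Bochner_Integration.integral_zero) (rule Lim_transform_eventually)
  qed
  ultimately show ?thesis
    unfolding has_derivative_at_within by blast
qed

section \<open>The heat pairing as a Gaussian mean\<close>

text \<open>Substituting \<open>s = sqrt (2 * t) * y\<close> moves the time from the kernel into the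
  argument of \<open>\<psi>\<close>. The remaining weight is a fixed probability density, so zero
  and positive times are covered by one formula.\<close>

lemma heat_kernel_eq_gaussian:
  assumes "t \<ge> 0"
  shows "heat_kernel t \<psi> = (LINT y|lborel. std_normal_density y * \<psi> (sqrt (2 * t) * y))"
proof (cases "t = 0")
  case True
  \<comment> \<open>The moment of order zero is the total mass 1 of the density.\<close>
  then show ?thesis
    using integral_std_normal_moment_even[of 0] by (simp add: heat_kernel_def)
next
  case False
  with assms have t: "t > 0"
    by simp
  let ?c = "sqrt (2 * t)"
  have c: "?c > 0" "?c\<^sup>2 = 2 * t"
    using t by simp_all
  have sq: "sqrt (4 * pi * t) = sqrt (2 * pi) * ?c"
    unfolding real_sqrt_mult[symmetric] by (simp add: mult.assoc)
  have "heat_kernel t \<psi> = \<bar>?c\<bar> *\<^sub>R (LINT y|lborel. exp (- (0 + ?c * y)\<^sup>2 / (4 * t)) / sqrt (4 * pi * t) * \<psi> (0 + ?c * y))"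
    unfolding heat_kernel_def using t c by (subst lborel_integral_real_affine[of ?c _ 0]) auto
  also have "\<dots> = (LINT y|lborel. ?c * (exp (- (?c * y)\<^sup>2 / (4 * t)) / sqrt (4 * pi * t) * \<psi> (?c * y)))"
    using c(1) by simp
  also have "\<dots> = (LINT y|lborel. std_normal_density y * \<psi> (?c * y))"
  proof (rule Bochner_Integration.integral_cong[OF refl])
    fix y
    have "- (?c * y)\<^sup>2 / (4 * t) = - y\<^sup>2 / 2"
      using t c(2) by (simp add: power_mult_distrib)
    then show "?c * (exp (- (?c * y)\<^sup>2 / (4 * t)) / sqrt (4 * pi * t) * \<psi> (?c * y)) =
        std_normal_density y * \<psi> (?c * y)"
      unfolding std_normal_density_def sq using c(1) by simp
  qed
  finally show ?thesis .
qed

text \<open>Absolute Gaussian moments are the majorants: \<open>k = 0\<close> serves bounded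
  functions, \<open>k = 1\<close> those with an extra factor \<open>y\<close>.\<close>

lemma integrable_std_normal_mult:
  assumes [measurable]: "g \<in> borel_measurable borel" and "\<And>y. \<bar>g y\<bar> \<le> M * \<bar>y\<bar> ^ k"
  shows "integrable lborel (\<lambda>y. std_normal_density y * g y)"
proof (rule Bochner_Integration.integrable_bound)
  show "integrable lborel (\<lambda>y. M * (std_normal_density y * \<bar>y\<bar> ^ k))"
    by (intro integrable_mult_right integrable_std_normal_moment_abs)
  have "\<bar>std_normal_density y * g y\<bar> \<le> std_normal_density y * (M * \<bar>y\<bar> ^ k)" for y
    using assms(2)[of y] by (simp add: abs_mult mult_left_mono)
  then show "AE y in lborel. norm (std_normal_density y * g y) \<le> norm (M * (std_normal_density y * \<bar>y\<bar> ^ k))"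
    by (intro AE_I2) (simp add: mult.left_commute order_trans[OF _ abs_ge_self])
qed measurable

text \<open>In Gaussian form the parameters enter through the argument of \<open>\<phi>\<close>,
  continuously up to \<open>t = 0\<close>; a local bound of \<open>\<phi>\<close> times the density
  is the majorant.\<close>

lemma continuous_on_heat_kernel:
  fixes U :: "'a::cartesian_space set"
  assumes "open U" "test_plot U \<phi>"
  shows "continuous_on (U \<times> {0..}) (\<lambda>(u, t). heat_kernel t (\<lambda>x. \<phi> (u, x)))"
proof -
  let ?f = "\<lambda>z y. std_normal_density y * \<phi> (fst z, sqrt (2 * snd z) * y)"
  have "continuous_on (U \<times> {0..}) (\<lambda>z. LINT y|lborel. ?f z y)"
    unfolding continuous_on_def
  proof
    fix z0 :: "'a \<times> real" assume z0: "z0 \<in> U \<times> {0..}"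
    then have "fst z0 \<in> U"
      by auto
    obtain W M where W: "open W" "fst z0 \<in> W" "W \<subseteq> U" "\<forall>w\<in>W. \<forall>x. \<bar>\<phi> (w, x)\<bar> \<le> M"
      by (rule test_plot_locally_bounded[OF assms \<open>fst z0 \<in> U\<close>])
    have meas: "?f z \<in> borel_measurable lborel" if "fst z \<in> U" for z
      using measurable_compose[OF _ test_plot_measurable[OF assms(2) that], of "\<lambda>y. sqrt (2 * snd z) * y" lborel]
      by simp
    have ev: "\<forall>\<^sub>F z in at z0 within U \<times> {0..}. fst z \<in> W"
      using topological_tendstoD[OF tendsto_fst[OF tendsto_ident_at] W(1,2)] .
    show "((\<lambda>z. LINT y|lborel. ?f z y) \<longlongrightarrow> (LINT y|lborel. ?f z0 y)) (at z0 within U \<times> {0..})"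
    proof (rule tendsto_integral_dominated[where w = "\<lambda>y. std_normal_density y * M"])
      show "\<forall>\<^sub>F z in at z0 within U \<times> {0..}. ?f z \<in> borel_measurable lborel"
        using ev by eventually_elim (use meas W(3) in blast)
      show "?f z0 \<in> borel_measurable lborel"
        by (rule meas[OF \<open>fst z0 \<in> U\<close>])
      show "integrable lborel (\<lambda>y. std_normal_density y * M)"
        using integrable_std_normal_moment_abs[of 0] by simp
      show "\<forall>\<^sub>F z in at z0 within U \<times> {0..}. \<forall>y. \<bar>?f z y\<bar> \<le> std_normal_density y * M"
        using ev by eventually_elim (use W(4) in \<open>simp add: abs_mult mult_left_mono\<close>)
      show "((\<lambda>z. ?f z y) \<longlongrightarrow> ?f z0 y) (at z0 within U \<times> {0..})" for y
      proof (rule tendsto_mult_left)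
        have "continuous_on (U \<times> {0..}) (\<lambda>z. \<phi> (fst z, sqrt (2 * snd z) * y))"
          by (rule continuous_on_compose2[OF smooth_on_continuous_on[OF test_plotD_smooth[OF assms(2)]]])
             (auto intro!: continuous_intros)
        then show "((\<lambda>z. \<phi> (fst z, sqrt (2 * snd z) * y)) \<longlongrightarrow> \<phi> (fst z0, sqrt (2 * snd z0) * y))
            (at z0 within U \<times> {0..})"
          using z0 unfolding continuous_on_def by blast
      qed
    qed
  qed
  then show ?thesis
    by (rule continuous_on_eq) (auto simp: heat_kernel_eq_gaussian)
qed

text \<open>With the time frozen this is differentiation under the Gaussian integral; the density
  times the local Lipschitz constant \<open>L\<close> is the majorant.\<close>

lemma heat_kernel_has_derivative_fst:
  fixes U :: "'a::cartesian_space set"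
  assumes "open U" "test_plot U \<phi>" "u \<in> U" "t \<ge> 0"
  shows "((\<lambda>u. heat_kernel t (\<lambda>x. \<phi> (u, x))) has_derivative
      (\<lambda>h. heat_kernel t (\<lambda>x. dir_deriv (h, 0) \<phi> (u, x)))) (at u)"
proof -
  let ?c = "sqrt (2 * t)"
  obtain r L where r: "r > 0" "ball u r \<subseteq> U"
      "\<And>w x. w \<in> ball u r \<Longrightarrow> \<bar>\<phi> (w, x) - \<phi> (u, x)\<bar> \<le> L * norm (w - u)"
      "\<And>h x. \<bar>dir_deriv (h, 0) \<phi> (u, x)\<bar> \<le> L * norm h"
    using test_plot_locally_lipschitz[OF assms(1-3)] by blast
  obtain M where M: "\<forall>x. \<bar>\<phi> (u, x)\<bar> \<le> M"
    by (rule test_plot_bounded[OF assms(1-3)])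
  have meas: "(\<lambda>y. \<psi> (w, ?c * y)) \<in> borel_measurable borel" if "test_plot U \<psi>" "w \<in> U" for \<psi> w
    using measurable_compose[OF _ test_plot_measurable[OF that], of "\<lambda>y. ?c * y" borel] by simp
  have ev: "\<forall>\<^sub>F w in at u. w \<in> ball u r"
    using r(1) by (intro eventually_at_in_open') auto
  have "((\<lambda>u. LINT y|lborel. std_normal_density y * \<phi> (u, ?c * y)) has_derivative
      (\<lambda>h. LINT y|lborel. std_normal_density y * dir_deriv (h, 0) \<phi> (u, ?c * y))) (at u)"
  proof (rule has_derivative_integral_dominated[where w = "\<lambda>y. std_normal_density y * L"])
    show "\<forall>\<^sub>F w in at u. (\<lambda>y. std_normal_density y * \<phi> (w, ?c * y)) \<in> borel_measurable lborel"
      using ev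
    proof eventually_elim
      case (elim w)
      then have "w \<in> U"
        using r(2) by blast
      then show ?case
        using meas[OF assms(2)] by simp
    qed
    show "(\<lambda>y. std_normal_density y * dir_deriv (h, 0) \<phi> (u, ?c * y)) \<in> borel_measurable lborel" for h
      using meas[OF test_plot_dir_deriv[OF assms(2)] assms(3)] by simp
    show "integrable lborel (\<lambda>y. std_normal_density y * \<phi> (u, ?c * y))"
      by (rule integrable_std_normal_mult[where k = 0 and M = M, OF meas[OF assms(2,3)]]) (use M in simp)
    show "integrable lborel (\<lambda>y. std_normal_density y * L)"
      using integrable_std_normal_moment_abs[of 0] by simp
    show "\<forall>\<^sub>F w in at u. \<forall>y. \<bar>std_normal_density y * \<phi> (w, ?c * y) - std_normal_density y * \<phi> (u, ?c * y)\<bar>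
        \<le> std_normal_density y * L * norm (w - u)"
      using ev
    proof eventually_elim
      case (elim w)
      show ?case
        using r(3)[OF elim]
        by (simp add: right_diff_distrib[symmetric] abs_mult mult.assoc mult_left_mono)
    qed
    show "\<bar>std_normal_density y * dir_deriv (h, 0) \<phi> (u, ?c * y)\<bar> \<le> std_normal_density y * L * norm h" for y h
      using r(4) by (simp add: abs_mult mult.assoc mult_left_mono)
    show "((\<lambda>w. std_normal_density y * \<phi> (w, ?c * y)) has_derivative
        (\<lambda>h. std_normal_density y * dir_deriv (h, 0) \<phi> (u, ?c * y))) (at u)" for y
      by (intro has_derivative_mult_right test_plot_has_derivative_fst[OF assms(2,3)])
  qed
  then show ?thesis
    by (simp add: heat_kernel_eq_gaussian[OF assms(4)])
qed

section \<open>Gaussian means as functions of the scale\<close>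

lemma has_real_derivative_std_normal_density:
  "(std_normal_density has_real_derivative - y * std_normal_density y) (at y)"
  unfolding std_normal_density_def[abs_def]
  by (auto intro!: derivative_eq_intros simp: field_simps)

lemma tendsto_std_normal_density:
  "(std_normal_density \<longlongrightarrow> 0) at_top" "(std_normal_density \<longlongrightarrow> 0) at_bot"
proof -
  have "LIM x at_top. (1 / 2) * (x::real)\<^sup>2 :> at_top"
    by (rule filterlim_tendsto_pos_mult_at_top[OF tendsto_const _ filterlim_pow_at_top[OF _ filterlim_ident]]) auto
  then have "LIM x at_top. - ((1 / 2) * (x::real)\<^sup>2) :> at_bot"
    by (simp add: filterlim_uminus_at_top)
  from filterlim_compose[OF exp_at_bot this]
  have "((\<lambda>x. 1 / sqrt (2 * pi) * exp (- ((1 / 2) * (x::real)\<^sup>2))) \<longlongrightarrow> 1 / sqrt (2 * pi) * 0) at_top"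
    by (intro tendsto_mult tendsto_const)
  then show top: "(std_normal_density \<longlongrightarrow> 0) at_top"
    unfolding std_normal_density_def[abs_def] by simp
  have "std_normal_density (- x) = std_normal_density x" for x
    by (simp add: std_normal_density_def)
  with top show "(std_normal_density \<longlongrightarrow> 0) at_bot"
    unfolding filterlim_at_bot_mirror by simp
qed

text \<open>Integrate by parts, using that \<open>y \<gamma>(y) = - \<gamma>'(y)\<close> for the Gaussian density \<open>\<gamma>\<close>.\<close>

lemma gaussian_integral_by_parts:
  assumes g': "\<And>x. (g has_real_derivative g' x) (at x)" and cont: "continuous_on UNIV g'"
    and M: "\<And>x. \<bar>g x\<bar> \<le> M" "\<And>x. \<bar>g' x\<bar> \<le> M"
  shows "(LINT y|lborel. std_normal_density y * (y * g (w * y))) =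
    w * (LINT y|lborel. std_normal_density y * g' (w * y))"
proof -
  have cg: "continuous_on UNIV g"
    by (intro continuous_at_imp_continuous_on ballI DERIV_isCont[OF g'])
  have cgw: "continuous_on UNIV (\<lambda>y. g (w * y))" "continuous_on UNIV (\<lambda>y. g' (w * y))"
    by (rule continuous_on_compose2[OF cg] continuous_on_compose2[OF cont]; auto intro!: continuous_intros)+
  have meas: "(\<lambda>y. y * g (w * y)) \<in> borel_measurable borel" "(\<lambda>y. g' (w * y)) \<in> borel_measurable borel"
    by (intro borel_measurable_continuous_onI continuous_intros cgw)+
  have int: "integrable lborel (\<lambda>y. std_normal_density y * (y * g (w * y)))"
      "integrable lborel (\<lambda>y. std_normal_density y * g' (w * y))"
  proof -
    show "integrable lborel (\<lambda>y. std_normal_density y * (y * g (w * y)))"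
      by (rule integrable_std_normal_mult[where k = 1 and M = M, OF meas(1)])
         (simp add: abs_mult M(1) mult_left_mono mult.commute[of M])
    show "integrable lborel (\<lambda>y. std_normal_density y * g' (w * y))"
      by (rule integrable_std_normal_mult[where k = 0 and M = M, OF meas(2)]) (simp add: M(2))
  qed
  let ?f = "\<lambda>y. std_normal_density y * (y * g (w * y)) - w * (std_normal_density y * g' (w * y))"
  \<comment> \<open>\<open>?F\<close> is an antiderivative of \<open>?f\<close>: differentiating the
    density gives the term with factor \<open>y\<close>, differentiating \<open>g (w * y)\<close>
    the one with factor \<open>w\<close>. It vanishes at both ends because \<open>g\<close> is
    bounded, so \<open>?f\<close> has integral zero.\<close>
  let ?F = "\<lambda>y. - (std_normal_density y * g (w * y))"
  have lim: "(?F \<longlongrightarrow> 0) F" if "(std_normal_density \<longlongrightarrow> 0) F" for F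
  proof (rule Lim_null_comparison)
    show "\<forall>\<^sub>F y in F. norm (?F y) \<le> std_normal_density y * M"
      using M(1) by (intro always_eventually) (simp add: abs_mult mult_left_mono)
    show "((\<lambda>y. std_normal_density y * M) \<longlongrightarrow> 0) F"
      using tendsto_mult_right[OF that, of M] by simp
  qed
  have dens: "continuous_on UNIV std_normal_density"
    by (intro continuous_at_imp_continuous_on ballI DERIV_isCont[OF has_real_derivative_std_normal_density])
  have "(LBINT y=-\<infinity>..\<infinity>. ?f y) = 0 - 0"
  proof (rule interval_integral_FTC_integrable)
    show "(?F has_vector_derivative ?f y) (at y)" for y
    proof -
      have "((\<lambda>y. g (w * y)) has_real_derivative g' (w * y) * w) (at y)"
        by (rule DERIV_chain2[OF g']) (auto intro!: derivative_eq_intros)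
      from DERIV_minus[OF DERIV_mult[OF has_real_derivative_std_normal_density this]]
      show ?thesis
        by (simp add: has_real_derivative_iff_has_vector_derivative[symmetric] algebra_simps)
    qed
    have "continuous_on UNIV ?f"
      by (intro continuous_intros dens cgw)
    then show "isCont ?f y" for y
      by (simp add: continuous_on_eq_continuous_at)
    show "set_integrable lborel (einterval (-\<infinity>) \<infinity>) ?f"
      using int by (simp add: set_integrable_def)
    show "((?F \<circ> real_of_ereal) \<longlongrightarrow> 0) (at_right (-\<infinity>))" "((?F \<circ> real_of_ereal) \<longlongrightarrow> 0) (at_left \<infinity>)"
      unfolding ereal_tendsto_simps by (intro lim tendsto_std_normal_density)+
  qed simp
  moreover have "(LBINT y=-\<infinity>..\<infinity>. ?f y) =
      (LINT y|lborel. std_normal_density y * (y * g (w * y))) - w * (LINT y|lborel. std_normal_density y * g' (w * y))"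
    using int by (simp add: interval_lebesgue_integral_def set_lebesgue_integral_def)
  ultimately show ?thesis
    by simp
qed

text \<open>With the scale \<open>w\<close> as parameter instead of the time, the integrand is
  differentiable at every real \<open>w\<close>. The bound on \<open>g'\<close> makes
  \<open>g\<close> Lipschitz with constant \<open>M\<close>, so the first absolute moment supplies
  the majorant.\<close>

lemma gaussian_mean_has_real_derivative:
  assumes g': "\<And>x. (g has_real_derivative g' x) (at x)" and cont: "continuous_on UNIV g'"
    and M: "\<And>x. \<bar>g x\<bar> \<le> M" "\<And>x. \<bar>g' x\<bar> \<le> M"
  shows "((\<lambda>w. LINT y|lborel. std_normal_density y * g (w * y)) has_real_derivative
    (LINT y|lborel. std_normal_density y * (y * g' (w * y)))) (at w)"
proof -
  have cg: "continuous_on UNIV g"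
    by (intro continuous_at_imp_continuous_on ballI DERIV_isCont[OF g'])
  have cgw: "continuous_on UNIV (\<lambda>y. g (w * y))" "continuous_on UNIV (\<lambda>y. g' (w * y))" for w
    by (rule continuous_on_compose2[OF cg] continuous_on_compose2[OF cont]; auto intro!: continuous_intros)+
  have meas [measurable]: "(\<lambda>y. g (w * y)) \<in> borel_measurable borel" "(\<lambda>y. g' (w * y)) \<in> borel_measurable borel" for w
    by (intro borel_measurable_continuous_onI cgw)+
  have "((\<lambda>w. LINT y|lborel. std_normal_density y * g (w * y)) has_derivative
      (\<lambda>h. LINT y|lborel. std_normal_density y * (y * g' (w * y)) * h)) (at w)"
  proof (rule has_derivative_integral_dominated[where w = "\<lambda>y. M * (std_normal_density y * \<bar>y\<bar> ^ 1)"])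
    show "integrable lborel (\<lambda>y. std_normal_density y * g (w * y))"
      by (rule integrable_std_normal_mult[where k = 0 and M = M, OF meas(1)]) (use M in simp)
    show "integrable lborel (\<lambda>y. M * (std_normal_density y * \<bar>y\<bar> ^ 1))"
      by (intro integrable_mult_right integrable_std_normal_moment_abs)
    have lip: "\<bar>g a - g b\<bar> \<le> M * \<bar>a - b\<bar>" for a b
      using field_differentiable_bound[of UNIV g g' M a b] g' M(2) by simp
    have "\<bar>std_normal_density y * g (z * y) - std_normal_density y * g (w * y)\<bar>
        \<le> M * (std_normal_density y * \<bar>y\<bar> ^ 1) * norm (z - w)" for z y
    proof -
      have "\<bar>std_normal_density y * g (z * y) - std_normal_density y * g (w * y)\<bar> =
          std_normal_density y * \<bar>g (z * y) - g (w * y)\<bar>"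
        by (simp add: right_diff_distrib[symmetric] abs_mult)
      also have "\<dots> \<le> std_normal_density y * (M * \<bar>z * y - w * y\<bar>)"
        by (intro mult_left_mono lip) simp
      also have "\<dots> = M * (std_normal_density y * \<bar>y\<bar> ^ 1) * norm (z - w)"
        by (simp add: left_diff_distrib[symmetric] abs_mult)
      finally show ?thesis .
    qed
    then show "\<forall>\<^sub>F z in at w. \<forall>y. \<bar>std_normal_density y * g (z * y) - std_normal_density y * g (w * y)\<bar>
        \<le> M * (std_normal_density y * \<bar>y\<bar> ^ 1) * norm (z - w)"
      by simp
    show "\<bar>std_normal_density y * (y * g' (w * y)) * h\<bar> \<le> M * (std_normal_density y * \<bar>y\<bar> ^ 1) * norm h" for y h
    proof -
      have "\<bar>std_normal_density y * (y * g' (w * y)) * h\<bar> = \<bar>g' (w * y)\<bar> * (std_normal_density y * \<bar>y\<bar> * \<bar>h\<bar>)"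
        by (simp add: abs_mult)
      also have "\<dots> \<le> M * (std_normal_density y * \<bar>y\<bar> * \<bar>h\<bar>)"
        by (intro mult_right_mono M(2)) simp
      finally show ?thesis
        by (simp add: mult.assoc)
    qed
    show "((\<lambda>w. std_normal_density y * g (w * y)) has_derivative
        (\<lambda>h. std_normal_density y * (y * g' (w * y)) * h)) (at w)" for y
    proof -
      have "((\<lambda>w. g (w * y)) has_real_derivative g' (w * y) * y) (at w)"
        by (rule DERIV_chain2[OF g']) (auto intro!: derivative_eq_intros)
      from DERIV_cmult[OF this, of "std_normal_density y"] show ?thesis
        unfolding has_field_derivative_def
        by (rule has_derivative_eq_rhs) (simp add: fun_eq_iff)
    qed
  qed measurable
  then show ?thesis
    by (simp add: has_field_derivative_def)
qed

section \<open>Smoothness of the heat pairing\<close>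

text \<open>Bounded functions are integrable against the density, so the integral is additive on
  them. This merges the two terms of the total derivative into a single pairing.\<close>

lemma heat_kernel_add_mult:
  assumes "open U" "test_plot U \<phi>" "test_plot U \<psi>" "u \<in> U" "t \<ge> 0"
  shows "heat_kernel t (\<lambda>x. \<phi> (u, x) + c * \<psi> (u, x)) =
    heat_kernel t (\<lambda>x. \<phi> (u, x)) + c * heat_kernel t (\<lambda>x. \<psi> (u, x))"
proof -
  have int: "integrable lborel (\<lambda>y. std_normal_density y * \<psi> (u, sqrt (2 * t) * y))"
    if tp: "test_plot U \<psi>" for \<psi>
  proof -
    obtain M where M: "\<forall>x. \<bar>\<psi> (u, x)\<bar> \<le> M"
      by (rule test_plot_bounded[OF assms(1) tp assms(4)])
    have "(\<lambda>y. \<psi> (u, sqrt (2 * t) * y)) \<in> borel_measurable borel"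
      using measurable_compose[OF _ test_plot_measurable[OF tp assms(4)], of "\<lambda>y. sqrt (2 * t) * y" borel]
      by simp
    then show ?thesis
      by (rule integrable_std_normal_mult[where k = 0 and M = M]) (use M in simp)
  qed
  have "std_normal_density y * (\<phi> (u, z) + c * \<psi> (u, z)) =
      std_normal_density y * \<phi> (u, z) + c * (std_normal_density y * \<psi> (u, z))" for y z
    by (simp add: algebra_simps)
  then show ?thesis
    using int[OF assms(2)] int[OF assms(3)] by (simp add: heat_kernel_eq_gaussian[OF assms(5)])
qed

text \<open>
  The heat equation. With \<open>w = sqrt (2 * t)\<close>, the \<open>w\<close>-derivative of the Gaussian mean of
  \<open>\<psi> (w y)\<close> is \<open>w\<close> times the mean of \<open>\<psi>'' (w y)\<close>, and this \<open>w\<close> cancels the singular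
  factor \<open>1 / w\<close> of the derivative of \<open>sqrt (2 * t)\<close>.
\<close>

lemma heat_kernel_has_real_derivative_pos:
  assumes "open U" "test_plot U \<phi>" "u \<in> U" "t > 0"
  shows "((\<lambda>t. heat_kernel t (\<lambda>x. \<phi> (u, x))) has_real_derivative
      heat_kernel t (\<lambda>x. dir_deriv (0, 1) (dir_deriv (0, 1) \<phi>) (u, x))) (at t)"
proof -
  let ?D = "dir_deriv (0, 1)"
  have tp: "test_plot U (?D \<phi>)" "test_plot U (?D (?D \<phi>))"
    by (intro test_plot_dir_deriv assms(2))+
  obtain M0 where M0: "\<forall>x. \<bar>\<phi> (u, x)\<bar> \<le> M0"
    by (rule test_plot_bounded[OF assms(1,2,3)])
  obtain M1 where M1: "\<forall>x. \<bar>?D \<phi> (u, x)\<bar> \<le> M1"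
    by (rule test_plot_bounded[OF assms(1) tp(1) assms(3)])
  obtain M2 where M2: "\<forall>x. \<bar>?D (?D \<phi>) (u, x)\<bar> \<le> M2"
    by (rule test_plot_bounded[OF assms(1) tp(2) assms(3)])
  \<comment> \<open>One constant has to bound a function together with its derivative, both for
    \<open>\<phi>\<close> and for \<open>?D \<phi>\<close>.\<close>
  define M where "M = max M0 (max M1 M2)"
  have M: "\<bar>\<phi> (u, x)\<bar> \<le> M" "\<bar>?D \<phi> (u, x)\<bar> \<le> M" "\<bar>?D (?D \<phi>) (u, x)\<bar> \<le> M" for x
    using M0[rule_format, of x] M1[rule_format, of x] M2[rule_format, of x] by (simp_all add: M_def)
  let ?A = "\<lambda>\<psi> w. LINT y|lborel. std_normal_density y * \<psi> (u, w * y)"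
  let ?w = "sqrt (2 * t)"
  have "(?A \<phi> has_real_derivative (LINT y|lborel. std_normal_density y * (y * ?D \<phi> (u, ?w * y)))) (at ?w)"
    by (rule gaussian_mean_has_real_derivative[OF test_plot_has_derivative_snd[OF assms(2,3)]
          test_plot_continuous_on_snd[OF tp(1) assms(3)] M(1,2)])
  moreover have "(LINT y|lborel. std_normal_density y * (y * ?D \<phi> (u, ?w * y))) = ?w * ?A (?D (?D \<phi>)) ?w"
    by (rule gaussian_integral_by_parts[OF test_plot_has_derivative_snd[OF tp(1) assms(3)]
          test_plot_continuous_on_snd[OF tp(2) assms(3)] M(2,3)])
  ultimately have "(?A \<phi> has_real_derivative ?w * ?A (?D (?D \<phi>)) ?w) (at ?w)"
    by simp
  moreover have "((\<lambda>t. sqrt (2 * t)) has_real_derivative 1 / ?w) (at t)"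
    using assms(4) by (auto intro!: derivative_eq_intros simp: field_simps)
  ultimately have "((\<lambda>t. ?A \<phi> (sqrt (2 * t))) has_real_derivative ?w * ?A (?D (?D \<phi>)) ?w * (1 / ?w)) (at t)"
    by (rule DERIV_chain2)
  then have "((\<lambda>t. ?A \<phi> (sqrt (2 * t))) has_real_derivative heat_kernel t (\<lambda>x. ?D (?D \<phi>) (u, x))) (at t)"
    using assms(4) by (simp add: heat_kernel_eq_gaussian)
  then show ?thesis
    \<comment> \<open>The Gaussian formula is available for nonnegative times, so the derivative is
      transferred on the open half-line containing \<open>t\<close>.\<close>
    by (rule has_field_derivative_transform_within_open[where S = "{0<..}"])
       (use assms(4) in \<open>auto simp: heat_kernel_eq_gaussian\<close>)
qed

section \<open>The heat equation up to time zero\<close>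

lemma continuous_on_heat_kernel_time:
  fixes U :: "'a::cartesian_space set"
  assumes "open U" "test_plot U \<phi>" "u \<in> U"
  shows "continuous_on {0..} (\<lambda>t. heat_kernel t (\<lambda>x. \<phi> (u, x)))"
proof -
  have "continuous_on {0..} (\<lambda>t. (\<lambda>(u, t). heat_kernel t (\<lambda>x. \<phi> (u, x))) (u, t))"
    by (rule continuous_on_compose2[OF continuous_on_heat_kernel[OF assms(1,2)]])
       (use assms(3) in \<open>auto intro!: continuous_intros\<close>)
  then show ?thesis
    by simp
qed

text \<open>At time zero, the mean value theorem turns the difference quotient into the value of the
  candidate derivative at an intermediate time, and that candidate is continuous up to zero.\<close>

lemma heat_kernel_has_real_derivative_within:
  fixes U :: "'a::cartesian_space set"
  assumes "open U" "test_plot U \<phi>" "u \<in> U" "t \<ge> 0"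
  shows "((\<lambda>t. heat_kernel t (\<lambda>x. \<phi> (u, x))) has_real_derivative
      heat_kernel t (\<lambda>x. dir_deriv (0, 1) (dir_deriv (0, 1) \<phi>) (u, x))) (at t within {0..})"
proof (cases "t = 0")
  case False
  then show ?thesis
    using assms by (intro has_field_derivative_at_within[OF heat_kernel_has_real_derivative_pos[OF assms(1-3)]]) simp
next
  case True
  let ?h = "\<lambda>t. heat_kernel t (\<lambda>x. \<phi> (u, x))"
  let ?k = "\<lambda>t. heat_kernel t (\<lambda>x. dir_deriv (0, 1) (dir_deriv (0, 1) \<phi>) (u, x))"
  have cont_k: "continuous_on {0..} ?k"
    by (rule continuous_on_heat_kernel_time[OF assms(1) test_plot_dir_deriv[OF test_plot_dir_deriv[OF assms(2)]] assms(3)])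
  have "((\<lambda>s. (?h s - ?h 0) / (s - 0)) \<longlongrightarrow> ?k 0) (at 0 within {0..})"
    unfolding Lim_within
  proof (intro allI impI)
    fix e :: real assume "e > 0"
    then obtain d where d: "d > 0" "\<And>s. s \<in> {0..} \<Longrightarrow> dist s 0 < d \<Longrightarrow> dist (?k s) (?k 0) < e"
      using cont_k[unfolded continuous_on_iff, rule_format, of 0 e] by auto
    have "dist ((?h s - ?h 0) / (s - 0)) (?k 0) < e" if "s \<in> {0..}" "0 < dist s 0" "dist s 0 < d" for s
    proof -
      have s: "0 < s" "s < d"
        using that by auto
      \<comment> \<open>The derivative is used on the open interval, where the time is positive; at
        its endpoints continuity of \<open>?h\<close> suffices.\<close>
      obtain r where r: "0 < r" "r < s" "?h s - ?h 0 = ?k r * (s - 0)"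
      proof (rule mvt[OF s(1), of ?h "\<lambda>r x. ?k r * x"])
        show "continuous_on {0..s} ?h"
          by (rule continuous_on_subset[OF continuous_on_heat_kernel_time[OF assms(1-3)]]) auto
        show "(?h has_derivative (\<lambda>x. ?k r * x)) (at r)" if "0 < r" for r
          using heat_kernel_has_real_derivative_pos[OF assms(1-3) that]
          unfolding has_field_derivative_def .
      qed
      have "(?h s - ?h 0) / (s - 0) = ?k r"
        unfolding r(3) using s(1) by simp
      then show ?thesis
        using d(2)[of r] r s by simp
    qed
    with d(1) show "\<exists>d>0. \<forall>s\<in>{0..}. 0 < dist s 0 \<and> dist s 0 < d \<longrightarrow> dist ((?h s - ?h 0) / (s - 0)) (?k 0) < e"
      by blast
  qed
  then show ?thesis
    unfolding True has_field_derivative_iff .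
qed

section \<open>Differentiation with variable time and the induction on k\<close>

text \<open>The function is the pairing composed with the graph
  \<open>v \<mapsto> (v, \<tau> v)\<close>, which stays in \<open>V \<times> {0..}\<close>. The
  chain rule is applied within that set, so the one-sided time derivative suffices where
  \<open>\<tau>\<close> vanishes.\<close>

lemma heat_kernel_has_derivative:
  fixes V :: "'v::cartesian_space set"
  assumes "open V" "test_plot V \<psi>" "v \<in> V"
    and \<tau>: "(\<tau> has_derivative \<tau>') (at v)" "\<And>w. w \<in> V \<Longrightarrow> \<tau> w \<ge> 0"
  shows "((\<lambda>v. heat_kernel (\<tau> v) (\<lambda>x. \<psi> (v, x))) has_derivative
      (\<lambda>h. heat_kernel (\<tau> v) (\<lambda>x. dir_deriv (h, 0) \<psi> (v, x) +
        \<tau>' h * dir_deriv (0, 1) (dir_deriv (0, 1) \<psi>) (v, x)))) (at v)"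
proof -
  let ?N = "\<lambda>v t. heat_kernel t (\<lambda>x. \<psi> (v, x))"
  let ?k = "\<lambda>v t. heat_kernel t (\<lambda>x. dir_deriv (0, 1) (dir_deriv (0, 1) \<psi>) (v, x))"
  have tp: "test_plot V (dir_deriv (0, 1) (dir_deriv (0, 1) \<psi>))"
    by (intro test_plot_dir_deriv assms)
  have total: "((\<lambda>(v, t). ?N v t) has_derivative
      (\<lambda>(h, s). heat_kernel (\<tau> v) (\<lambda>x. dir_deriv (h, 0) \<psi> (v, x)) + blinfun_mult_right (?k v (\<tau> v)) s))
      (at (v, \<tau> v) within V \<times> {0..})"
  \<comment> \<open>The total derivative follows from the partial in \<open>v\<close> at the point
    and a partial in \<open>t\<close> that exists on the whole set and is continuous at the point;
    \<open>blinfun_mult_right\<close> makes the latter a point of a normed space, so that its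
    continuity makes sense.\<close>
  proof (rule has_derivative_partialsI)
    show "((\<lambda>v'. ?N v' (\<tau> v)) has_derivative (\<lambda>h. heat_kernel (\<tau> v) (\<lambda>x. dir_deriv (h, 0) \<psi> (v, x))))
        (at v within V)"
      by (rule has_derivative_at_withinI[OF heat_kernel_has_derivative_fst[OF assms(1-3) \<tau>(2)[OF assms(3)]]])
    show "(?N w has_derivative blinfun_mult_right (?k w t)) (at t within {0..})"
      if "w \<in> V" "t \<in> {0..}" for w t
      using heat_kernel_has_real_derivative_within[OF assms(1,2) that(1), of t] that(2)
      unfolding has_field_derivative_def by simp
    have "continuous (at (v, \<tau> v) within V \<times> {0..}) (\<lambda>(v, t). ?k v t)"
      using continuous_on_heat_kernel[OF assms(1) tp] assms(3) \<tau>(2)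
      unfolding continuous_on_eq_continuous_within by blast
    from bounded_linear.continuous[OF bounded_linear_blinfun_mult_right this]
    show "continuous (at (v, \<tau> v) within V \<times> {0..}) (\<lambda>(v, t). blinfun_mult_right (?k v t))"
      by (simp add: case_prod_unfold)
  qed (use assms(3) \<tau>(2) in auto)
  have graph: "((\<lambda>v. (v, \<tau> v)) has_derivative (\<lambda>h. (h, \<tau>' h))) (at v within V)"
    by (intro has_derivative_Pair has_derivative_ident has_derivative_at_withinI[OF \<tau>(1)])
  have "(\<lambda>v. (v, \<tau> v)) ` V \<subseteq> V \<times> {0..}"
    using \<tau>(2) by auto
  from has_derivative_in_compose[OF graph has_derivative_subset[OF total this]]
  have "((\<lambda>v. ?N v (\<tau> v)) has_derivative
      (\<lambda>h. heat_kernel (\<tau> v) (\<lambda>x. dir_deriv (h, 0) \<psi> (v, x)) + ?k v (\<tau> v) * \<tau>' h)) (at v within V)"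
    by simp
  \<comment> \<open>Linearity gathers both terms into one pairing at time \<open>\<tau> v\<close>,
    the shape to which the induction can return.\<close>
  moreover have "heat_kernel (\<tau> v) (\<lambda>x. dir_deriv (h, 0) \<psi> (v, x) +
      \<tau>' h * dir_deriv (0, 1) (dir_deriv (0, 1) \<psi>) (v, x)) =
      heat_kernel (\<tau> v) (\<lambda>x. dir_deriv (h, 0) \<psi> (v, x)) + ?k v (\<tau> v) * \<tau>' h" for h
    using heat_kernel_add_mult[OF assms(1) test_plot_dir_deriv[OF assms(2)] tp assms(3) \<tau>(2)[OF assms(3)]]
    by (simp only: mult.commute)
  ultimately show ?thesis
    unfolding at_within_open[OF assms(3,1)] by (simp only:)
qed

lemma C_on_heat_kernel:
  fixes V :: "'v::cartesian_space set"
  assumes "open V" "smooth_on V \<tau>" "\<And>v. v \<in> V \<Longrightarrow> \<tau> v \<ge> 0" "test_plot V \<psi>"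
  shows "C_on k V (\<lambda>v. heat_kernel (\<tau> v) (\<lambda>x. \<psi> (v, x)))"
  using assms(4)
proof (induction k arbitrary: \<psi>)
  case 0
  have "continuous_on V (\<lambda>v. (\<lambda>(u, t). heat_kernel t (\<lambda>x. \<psi> (u, x))) (v, \<tau> v))"
    by (rule continuous_on_compose2[OF continuous_on_heat_kernel[OF assms(1) 0]])
       (use assms(3) in \<open>auto intro!: continuous_intros smooth_on_continuous_on[OF assms(2)]\<close>)
  then show ?case
    by simp
next
  case (Suc k)
  show ?case
  proof (rule C_on_SucI[OF assms(1)])
    show "((\<lambda>v. heat_kernel (\<tau> v) (\<lambda>x. \<psi> (v, x))) has_derivative
        (\<lambda>h. heat_kernel (\<tau> v) (\<lambda>x. dir_deriv (h, 0) \<psi> (v, x) +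
          dir_deriv h \<tau> v * dir_deriv (0, 1) (dir_deriv (0, 1) \<psi>) (v, x)))) (at v)"
      if "v \<in> V" for v
      by (rule heat_kernel_has_derivative[OF assms(1) Suc.prems that smooth_on_has_dir_deriv[OF assms(2) that] assms(3)])
    fix h
    \<comment> \<open>The factor \<open>dir_deriv h \<tau>\<close> depends on \<open>v\<close>
      alone, so multiplying by it preserves the support bound in \<open>x\<close>.\<close>
    have "test_plot V (\<lambda>z. dir_deriv (h, 0) \<psi> z +
        dir_deriv h \<tau> (fst z) * dir_deriv (0, 1) (dir_deriv (0, 1) \<psi>) z)"
      by (intro test_plot_add test_plot_mult test_plot_dir_deriv smooth_on_dir_deriv assms Suc.prems)
    from Suc.IH[OF this]
    show "C_on k V (\<lambda>v. heat_kernel (\<tau> v) (\<lambda>x. dir_deriv (h, 0) \<psi> (v, x) +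
          dir_deriv h \<tau> v * dir_deriv (0, 1) (dir_deriv (0, 1) \<psi>) (v, x)))"
      by simp
  qed
qed

theorem theorem4p3:
  fixes U :: "'a::cartesian_space set" and \<phi> :: "'a \<times> real \<Rightarrow> real"
  assumes "open U" and "test_plot U \<phi>"
  shows "diffeo_smooth_on TYPE('v::cartesian_space) (U \<times> {0..})
           (\<lambda>(u, t). heat_kernel t (\<lambda>x. \<phi> (u, x)))"
  unfolding diffeo_smooth_on_def
proof (intro allI impI)
  fix V :: "'v set" and p :: "'v \<Rightarrow> 'a \<times> real"
  assume V: "open V" and p: "smooth_on V p" "p ` V \<subseteq> U \<times> {0..}"
  have range: "fst (p v) \<in> U" "snd (p v) \<ge> 0" if "v \<in> V" for v
    using subsetD[OF p(2) imageI[OF that]] by (simp_all add: mem_Times_iff)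
  have q: "smooth_on V (\<lambda>v. fst (p v))" "smooth_on V (\<lambda>v. snd (p v))"
    by (rule smooth_on_bounded_linear[OF V bounded_linear_fst p(1)],
        rule smooth_on_bounded_linear[OF V bounded_linear_snd p(1)])
  \<comment> \<open>The first component of the plot is absorbed into the test plot; the second
    remains as the variable time.\<close>
  have "test_plot V (\<lambda>z. \<phi> (fst (p (fst z)), snd z))"
    by (rule test_plot_reparametrize[OF V q(1) _ assms(2)]) (use range(1) in blast)
  from C_on_heat_kernel[OF V q(2) range(2) this]
  show "smooth_on V ((\<lambda>(u, t). heat_kernel t (\<lambda>x. \<phi> (u, x))) \<circ> p)"
    by (simp add: smooth_on_def comp_def case_prod_unfold)
qed

end
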